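(* Let $A,B\in\mathbb{R}_+^{n\times n}$ commute in max algebra, i.e. $AB=BA$. Then for every eigencone $V(A,\alpha)$ of $A$ (where $\alpha\in\Lambda(A)$) there exists an eigencone $V(B,\mu)$ of $B$ (where $\mu\in\Lambda(B)$) such that $V(A,\alpha)\cap V(B,\mu)$ contains a nonzero vector.
   Context: Max algebra is the semiring $(\mathbb{R}_+,\oplus,\times)$, where $\mathbb{R}_+=[0,\infty)$, $a\oplus b=\max(a,b)$ and $\times$ is ordinary multiplication. All matrix and matrix-vector operations are over this semiring: $(AB)_{ij}=\max_k a_{ik}b_{kj}$ and $(Av)_i=\max_k a_{ik}v_k$. An eigenvalue of $A\in\mathbb{R}_+^{n\times n}$ is an $\alpha\in\mathbb{R}_+$ for which there is a nonzero $v\in\mathbb{R}_+^n$ (an eigenvector) with $Av=\alpha v$. $\Lambda(A)$ denotes the set of eigenvalues of $A$, and for $\alpha\in\Lambda(A)$ the eigencone of $A$ associated with $\alpha$ is $V(A,\alpha)=\{v\in\mathbb{R}_+^n\mid Av=\alpha v\}$. *)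

theory Defs
  imports "HOL-Analysis.Analysis"
begin

text \<open>
  Max algebra is rendered on \<open>real ^ 'n\<close> and \<open>real ^ 'n ^ 'n\<close>, with entrywise nonnegativity as
  an explicit predicate. The dimension is \<open>CARD('n)\<close>, so \<open>'n :: finite\<close> covers every positive
  dimension, and the maxima below range over finite nonempty sets.
\<close>

definition nonneg_vec :: "real ^ 'n \<Rightarrow> bool" where
  "nonneg_vec v \<longleftrightarrow> (\<forall>i. 0 \<le> v $ i)"

definition nonneg_mat :: "real ^ 'n ^ 'm \<Rightarrow> bool" where
  "nonneg_mat A \<longleftrightarrow> (\<forall>i j. 0 \<le> A $ i $ j)"

definition max_matrix_mult :: "real ^ 'n ^ 'm \<Rightarrow> real ^ 'p ^ 'n \<Rightarrow> real ^ 'p ^ 'm"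
    (infixl \<open>\<otimes>\<^sub>m\<close> 70) where
  "A \<otimes>\<^sub>m B = (\<chi> i j. MAX k. A $ i $ k * B $ k $ j)"

definition max_matrix_vector_mult :: "real ^ 'n ^ 'm \<Rightarrow> real ^ 'n \<Rightarrow> real ^ 'm"
    (infixl \<open>\<otimes>\<^sub>v\<close> 70) where
  "A \<otimes>\<^sub>v v = (\<chi> i. MAX k. A $ i $ k * v $ k)"

definition max_eigenvalues :: "real ^ 'n ^ 'n \<Rightarrow> real set" where
  "max_eigenvalues A =
     {\<alpha>. 0 \<le> \<alpha> \<and> (\<exists>v. nonneg_vec v \<and> v \<noteq> 0 \<and> A \<otimes>\<^sub>v v = \<alpha> *\<^sub>R v)}"

definition max_eigencone :: "real ^ 'n ^ 'n \<Rightarrow> real \<Rightarrow> (real ^ 'n) set" where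
  "max_eigencone A \<alpha> = {v. nonneg_vec v \<and> A \<otimes>\<^sub>v v = \<alpha> *\<^sub>R v}"

end

theory Submission imports Defs begin

text \<open>
  Since \<open>A\<close> and \<open>B\<close> commute, \<open>B\<close> maps the eigencone \<open>K = V(A,\<alpha>)\<close> into itself, so it suffices to
  find an eigenvector of \<open>B\<close> in an arbitrary closed nonzero cone \<open>K\<close> of nonnegative vectors that
  is closed under componentwise maximum and invariant under \<open>B\<close> (\<open>exists_eigenvector\<close>).
  The argument is variational, in the spirit of
  Collatz and Wielandt: the eigenvalue is the least \<open>r \<ge> 0\<close> for which some nonzero \<open>w \<in> K\<close>
  satisfies \<open>B w \<le> r w\<close>.

  Such an \<open>r\<close> exists. A vector of \<open>K\<close> with the largest possible support satisfies \<open>B w \<le> s w\<close> for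
  some \<open>s\<close>, because \<open>B w\<close> lies in \<open>K\<close> too and so vanishes wherever \<open>w\<close> does
  (\<open>exists_subeigenvector\<close>). On unit vectors the condition is compact, and the least \<open>s\<close> is attained
  (\<open>exists_least_subeigenvalue\<close>).

  If \<open>r = 0\<close> then \<open>B w = 0\<close>. Otherwise the iterates of \<open>B / r\<close> on \<open>w\<close> decrease to a vector \<open>u\<close>
  of \<open>K\<close>, and \<open>B u = r u\<close> by continuity; only \<open>u \<noteq> 0\<close> is at stake. If \<open>u\<close> were zero, some iterate
  would satisfy \<open>(B / r)\<^sup>m w \<le> w / 2\<close>, hence \<open>(B / s)\<^sup>m w \<le> w\<close> for some \<open>s < r\<close>. In max algebra
  this already gives a vector \<open>x \<in> K\<close> with \<open>B x \<le> s x\<close>, namely the maximum of the first \<open>m\<close>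
  iterates of \<open>B / s\<close> on \<open>w\<close> (\<open>subeigenvector_of_iterate\<close>), against the minimality of \<open>r\<close>.
\<close>

section \<open>Max-linear maps\<close>

lemma max_mv_nth: "(A \<otimes>\<^sub>v v) $ i = (MAX k. A $ i $ k * v $ k)"
  by (simp add: max_matrix_vector_mult_def)

lemma sup_vec_nth: "sup v w $ i = max (v $ i) ((w :: real ^ 'n) $ i)"
  by (simp add: sup_vec_def sup_max)

lemma nonneg_vec_iff_zero_le: "nonneg_vec v \<longleftrightarrow> 0 \<le> v"
  by (simp add: nonneg_vec_def less_eq_vec_def)

lemma nth_le_max_mv: "A $ i $ k * v $ k \<le> (A \<otimes>\<^sub>v v) $ i"
  by (simp add: max_mv_nth)

lemma max_mv_nth_le_iff: "(A \<otimes>\<^sub>v v) $ i \<le> c \<longleftrightarrow> (\<forall>k. A $ i $ k * v $ k \<le> c)"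
  by (auto simp add: max_mv_nth)

lemma max_mv_mono:
  assumes "nonneg_mat A" "v \<le> w"
  shows "A \<otimes>\<^sub>v v \<le> A \<otimes>\<^sub>v w"
  unfolding less_eq_vec_def max_mv_nth_le_iff
proof (intro allI)
  fix i k
  have "A $ i $ k * v $ k \<le> A $ i $ k * w $ k"
    using assms by (simp add: nonneg_mat_def less_eq_vec_def mult_left_mono)
  also have "\<dots> \<le> (A \<otimes>\<^sub>v w) $ i" by (rule nth_le_max_mv)
  finally show "A $ i $ k * v $ k \<le> (A \<otimes>\<^sub>v w) $ i" .
qed

lemma max_mv_nonneg:
  fixes v :: "real ^ 'n"
  assumes "nonneg_mat A" "0 \<le> v"
  shows "0 \<le> A \<otimes>\<^sub>v v"
  unfolding less_eq_vec_def
proof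
  fix i
  have "0 \<le> A $ i $ undefined * v $ undefined"
    using assms by (simp add: nonneg_mat_def less_eq_vec_def)
  also have "\<dots> \<le> (A \<otimes>\<^sub>v v) $ i" by (rule nth_le_max_mv)
  finally show "0 $ i \<le> (A \<otimes>\<^sub>v v) $ i" by simp
qed

lemma max_mv_scaleR:
  fixes v :: "real ^ 'n"
  assumes "0 \<le> c"
  shows "A \<otimes>\<^sub>v (c *\<^sub>R v) = c *\<^sub>R (A \<otimes>\<^sub>v v)"
proof -
  have "mono ((*) c)" using assms by (simp add: monoI mult_left_mono)
  from mono_Max_commute[OF this] have "c * Max (range f) = (MAX k. c * f k)"
    for f :: "'n \<Rightarrow> real" by (simp add: image_image)
  then show ?thesis by (simp add: vec_eq_iff max_mv_nth mult.left_commute)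
qed

lemma max_mv_sup:
  assumes "nonneg_mat A"
  shows "A \<otimes>\<^sub>v sup v w = sup (A \<otimes>\<^sub>v v) (A \<otimes>\<^sub>v w)"
proof (rule antisym)
  show "A \<otimes>\<^sub>v sup v w \<le> sup (A \<otimes>\<^sub>v v) (A \<otimes>\<^sub>v w)"
    unfolding less_eq_vec_def max_mv_nth_le_iff sup_vec_nth
  proof (intro allI)
    fix i k
    show "A $ i $ k * max (v $ k) (w $ k) \<le> max ((A \<otimes>\<^sub>v v) $ i) ((A \<otimes>\<^sub>v w) $ i)"
      using nth_le_max_mv[of A i k v] nth_le_max_mv[of A i k w]
      by (auto simp: max_def split: if_splits)
  qed
  show "sup (A \<otimes>\<^sub>v v) (A \<otimes>\<^sub>v w) \<le> A \<otimes>\<^sub>v sup v w"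
    using assms by (simp add: max_mv_mono)
qed

lemma max_mv_assoc:
  assumes "nonneg_mat A" "0 \<le> v"
  shows "(A \<otimes>\<^sub>m B) \<otimes>\<^sub>v v = A \<otimes>\<^sub>v (B \<otimes>\<^sub>v v)"
proof (rule antisym; unfold less_eq_vec_def max_mv_nth_le_iff; intro allI)
  fix i k
  have "(MAX l. A $ i $ l * B $ l $ k) \<in> range (\<lambda>l. A $ i $ l * B $ l $ k)"
    by (rule Max_in) auto
  then obtain l where "(MAX l. A $ i $ l * B $ l $ k) = A $ i $ l * B $ l $ k"
    by blast
  then have l: "(A \<otimes>\<^sub>m B) $ i $ k = A $ i $ l * B $ l $ k"
    by (simp add: max_matrix_mult_def)
  have "A $ i $ l * (B $ l $ k * v $ k) \<le> A $ i $ l * (B \<otimes>\<^sub>v v) $ l"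
    using assms by (intro mult_left_mono nth_le_max_mv) (simp add: nonneg_mat_def)
  also have "\<dots> \<le> (A \<otimes>\<^sub>v (B \<otimes>\<^sub>v v)) $ i" by (rule nth_le_max_mv)
  finally show "(A \<otimes>\<^sub>m B) $ i $ k * v $ k \<le> (A \<otimes>\<^sub>v (B \<otimes>\<^sub>v v)) $ i"
    by (simp add: l mult.assoc)
next
  fix i l
  have "(MAX k. B $ l $ k * v $ k) \<in> range (\<lambda>k. B $ l $ k * v $ k)"
    by (rule Max_in) auto
  then obtain k where k: "(B \<otimes>\<^sub>v v) $ l = B $ l $ k * v $ k"
    unfolding max_mv_nth by blast
  have "A $ i $ l * B $ l $ k \<le> (A \<otimes>\<^sub>m B) $ i $ k"
    by (simp add: max_matrix_mult_def)
  then have "A $ i $ l * B $ l $ k * v $ k \<le> (A \<otimes>\<^sub>m B) $ i $ k * v $ k"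
    using assms by (intro mult_right_mono) (auto simp: less_eq_vec_def)
  also have "\<dots> \<le> ((A \<otimes>\<^sub>m B) \<otimes>\<^sub>v v) $ i" by (rule nth_le_max_mv)
  finally show "A $ i $ l * (B \<otimes>\<^sub>v v) $ l \<le> ((A \<otimes>\<^sub>m B) \<otimes>\<^sub>v v) $ i"
    by (simp add: k mult.assoc)
qed

lemma continuous_on_Max_image:
  fixes f :: "'i \<Rightarrow> 'a::topological_space \<Rightarrow> real"
  assumes "finite I" "I \<noteq> {}" "\<And>i. i \<in> I \<Longrightarrow> continuous_on S (f i)"
  shows "continuous_on S (\<lambda>x. MAX i\<in>I. f i x)"
  using assms by (induction I rule: finite_ne_induct) (auto intro!: continuous_intros)

lemma continuous_on_max_mv [continuous_intros]:
  assumes "continuous_on S f"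
  shows "continuous_on S (\<lambda>x. A \<otimes>\<^sub>v f x)"
  unfolding max_matrix_vector_mult_def
  using assms by (intro continuous_intros continuous_on_Max_image) auto

lemma tendsto_max_mv:
  assumes "(f \<longlongrightarrow> l) F"
  shows "((\<lambda>x. A \<otimes>\<^sub>v f x) \<longlongrightarrow> A \<otimes>\<^sub>v l) F"
proof -
  have "isCont ((\<otimes>\<^sub>v) A) l"
    using continuous_on_max_mv[OF continuous_on_id, of UNIV A]
    by (simp add: continuous_on_eq_continuous_at)
  from isCont_tendsto_compose[OF this assms] show ?thesis .
qed

section \<open>Invariant max cones\<close>

locale invariant_max_cone =
  fixes B :: "real ^ 'n ^ 'n" and K :: "(real ^ 'n) set"
  assumes nonneg: "nonneg_mat B"
    and closed: "closed K"
    and pos: "\<And>v. v \<in> K \<Longrightarrow> 0 \<le> v"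
    and sup: "\<And>v w. v \<in> K \<Longrightarrow> w \<in> K \<Longrightarrow> sup v w \<in> K"
    and scale: "\<And>c v. 0 \<le> c \<Longrightarrow> v \<in> K \<Longrightarrow> c *\<^sub>R v \<in> K"
    and invariant: "\<And>v. v \<in> K \<Longrightarrow> B \<otimes>\<^sub>v v \<in> K"
begin

text \<open>
  Supports of vectors of \<open>K\<close> are closed under union, because \<open>K\<close> is closed under maxima; hence one
  of them contains all others. For a vector \<open>w\<close> with this support the quotients
  \<open>(B w)\<^sub>i / w\<^sub>i\<close> control \<open>B w\<close> completely.
\<close>

lemma exists_subeigenvector:
  assumes "v \<in> K" "v \<noteq> 0"
  shows "\<exists>s \<ge> 0. \<exists>w \<in> K. w \<noteq> 0 \<and> B \<otimes>\<^sub>v w \<le> s *\<^sub>R w"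
proof -
  define supp :: "real ^ 'n \<Rightarrow> 'n set" where "supp x = {i. x $ i \<noteq> 0}" for x
  have "\<exists>w. w \<in> K \<and> (\<forall>x. x \<in> K \<longrightarrow> card (supp x) \<le> card (supp w))"
    using assms by (intro ex_has_greatest_nat[of "\<lambda>x. x \<in> K" v _ "Suc CARD('n)"])
      (auto intro!: card_mono le_imp_less_Suc)
  then obtain w where w: "w \<in> K" "\<And>x. x \<in> K \<Longrightarrow> card (supp x) \<le> card (supp w)"
    by blast
  have max_supp: "supp x \<subseteq> supp w" if "x \<in> K" for x
  proof -
    have "0 \<le> x $ i" "0 \<le> w $ i" for i
      using pos[OF that] pos[OF w(1)] by (simp_all add: less_eq_vec_def)
    then have un: "supp (sup w x) = supp w \<union> supp x"
      by (auto simp: supp_def sup_vec_nth max_def antisym)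
    have "card (supp (sup w x)) \<le> card (supp w)"
      using w that by (simp add: sup)
    then have "supp w = supp w \<union> supp x"
      unfolding un by (intro card_seteq) auto
    then show ?thesis by blast
  qed
  have w0: "0 \<le> w $ i" for i
    using pos[OF w(1)] by (simp add: less_eq_vec_def)
  have Bw0: "0 \<le> (B \<otimes>\<^sub>v w) $ i" for i
    using pos[OF invariant[OF w(1)]] by (simp add: less_eq_vec_def)
  \<comment> \<open>The sum serves as an upper bound for all the quotients; where \<open>w\<close> vanishes the summand is zero.\<close>
  define s where "s = (\<Sum>i\<in>UNIV. (B \<otimes>\<^sub>v w) $ i / w $ i)"
  have "w \<noteq> 0"
    using max_supp[OF assms(1)] assms(2) by (auto simp: supp_def vec_eq_iff)
  moreover have "0 \<le> s"
    unfolding s_def using w0 Bw0 by (simp add: sum_nonneg)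
  moreover have "B \<otimes>\<^sub>v w \<le> s *\<^sub>R w"
    unfolding less_eq_vec_def
  proof
    fix i
    show "(B \<otimes>\<^sub>v w) $ i \<le> (s *\<^sub>R w) $ i"
    proof (cases "w $ i = 0")
      case True
      then have "(B \<otimes>\<^sub>v w) $ i = 0"
        using max_supp[OF invariant[OF w(1)]] by (auto simp: supp_def)
      then show ?thesis using True by simp
    next
      case False
      have "(B \<otimes>\<^sub>v w) $ i / w $ i \<le> s"
        unfolding s_def using w0 Bw0 by (intro member_le_sum) auto
      then show ?thesis using False w0[of i] by (simp add: field_simps)
    qed
  qed
  ultimately show ?thesis using w(1) by blast
qed

text \<open>
  The pairs of a number \<open>s\<close> and a unit vector \<open>x \<in> K\<close> with \<open>B x \<le> s x\<close> form a closed set. Once \<open>s\<close>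
  is bounded by one value that occurs, the set is compact, and the first coordinate attains its
  minimum.
\<close>

lemma exists_least_subeigenvalue:
  assumes "v \<in> K" "v \<noteq> 0"
  obtains r w where "0 \<le> r" "w \<in> K" "w \<noteq> 0" "B \<otimes>\<^sub>v w \<le> r *\<^sub>R w"
    "\<And>s x. 0 \<le> s \<Longrightarrow> x \<in> K \<Longrightarrow> x \<noteq> 0 \<Longrightarrow> B \<otimes>\<^sub>v x \<le> s *\<^sub>R x \<Longrightarrow> r \<le> s"
proof -
  have normalise: "\<exists>y \<in> K. norm y = 1 \<and> B \<otimes>\<^sub>v y \<le> s *\<^sub>R y"
    if "x \<in> K" "x \<noteq> 0" "B \<otimes>\<^sub>v x \<le> s *\<^sub>R x" for s x
  proof (rule bexI[of _ "(1 / norm x) *\<^sub>R x"])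
    have "(1 / norm x) *\<^sub>R (B \<otimes>\<^sub>v x) \<le> (1 / norm x) *\<^sub>R (s *\<^sub>R x)"
      using that by (intro scaleR_left_mono) auto
    then show "norm ((1 / norm x) *\<^sub>R x) = 1 \<and>
        B \<otimes>\<^sub>v ((1 / norm x) *\<^sub>R x) \<le> s *\<^sub>R ((1 / norm x) *\<^sub>R x)"
      using that by (simp add: max_mv_scaleR mult.commute)
  qed (use that scale in auto)
  obtain s0 w0 where s0: "0 \<le> s0" "w0 \<in> K" "w0 \<noteq> 0" "B \<otimes>\<^sub>v w0 \<le> s0 *\<^sub>R w0"
    using exists_subeigenvector[OF assms] by blast
  define T where "T = ({0..s0} \<times> (K \<inter> sphere 0 1)) \<inter>
    (\<Inter>i. {p. (B \<otimes>\<^sub>v snd p) $ i \<le> fst p * snd p $ i})"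
  have "compact T"
    unfolding T_def
    by (intro compact_Int_closed compact_Times closed_Int_compact closed closed_INT ballI
        closed_Collect_le continuous_intros compact_sphere compact_Icc)
  have T_iff: "(s, x) \<in> T \<longleftrightarrow>
      0 \<le> s \<and> s \<le> s0 \<and> x \<in> K \<and> norm x = 1 \<and> B \<otimes>\<^sub>v x \<le> s *\<^sub>R x" for s x
    by (auto simp: T_def less_eq_vec_def)
  have "T \<noteq> {}"
    using normalise[OF s0(2-4)] s0(1) T_iff by (metis empty_iff order_refl)
  have "continuous_on T fst" by (intro continuous_intros)
  from continuous_attains_inf[OF \<open>compact T\<close> \<open>T \<noteq> {}\<close> this]
  obtain r w where rw: "(r, w) \<in> T" "\<And>s x. (s, x) \<in> T \<Longrightarrow> r \<le> s" by force
  show ?thesis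
  proof
    show "0 \<le> r" "w \<in> K" "B \<otimes>\<^sub>v w \<le> r *\<^sub>R w" "w \<noteq> 0"
      using rw(1) by (auto simp: T_iff)
    fix s x assume s: "0 \<le> s" and x: "x \<in> K" "x \<noteq> 0" "B \<otimes>\<^sub>v x \<le> s *\<^sub>R x"
    show "r \<le> s"
    proof (cases "s \<le> s0")
      case True
      then show ?thesis using normalise[OF x] s rw(2) by (auto simp: T_iff)
    next
      case False
      then show ?thesis using rw(1) by (auto simp: T_iff)
    qed
  qed
qed

text \<open>
  Write \<open>C = B / s\<close>. The maximum of \<open>w, C w, \<dots>, C\<^sup>m w\<close> is mapped by \<open>C\<close> to the maximum of
  \<open>C w, \<dots>, C\<^sup>m\<^sup>+\<^sup>1 w\<close>, and the only new term is at most \<open>w\<close> by hypothesis.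
\<close>

lemma subeigenvector_of_iterate:
  assumes "0 < s" "w \<in> K" "w \<noteq> 0"
    and "((\<lambda>x. (1 / s) *\<^sub>R (B \<otimes>\<^sub>v x)) ^^ Suc m) w \<le> w"
  shows "\<exists>x \<in> K. x \<noteq> 0 \<and> B \<otimes>\<^sub>v x \<le> s *\<^sub>R x"
proof -
  define C where "C = (\<lambda>x. (1 / s) *\<^sub>R (B \<otimes>\<^sub>v x))"
  have C_mono: "C x \<le> C y" if "x \<le> y" for x y
    unfolding C_def using that assms(1) nonneg
    by (intro scaleR_left_mono max_mv_mono) auto
  have C_sup: "C (sup x y) = sup (C x) (C y)" for x y
  proof -
    have "mono (\<lambda>t. t / s)" using assms(1) by (simp add: monoI divide_right_mono)
    then have "max a b / s = max (a / s) (b / s)" for a b by (rule max_of_mono[symmetric])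
    then show ?thesis
      unfolding C_def max_mv_sup[OF nonneg] by (simp add: vec_eq_iff sup_vec_nth)
  qed
  have C_K: "C x \<in> K" if "x \<in> K" for x
    unfolding C_def using that assms(1) by (intro scale invariant) auto
  \<comment> \<open>Since \<open>C\<close> preserves maxima, this recursion computes the maximum of the iterates
    \<open>w, C w, \<dots>, C\<^sup>k w\<close>.\<close>
  define S where "S k = ((\<lambda>x. sup w (C x)) ^^ k) w" for k
  have S_Suc: "S (Suc k) = sup w (C (S k))" for k by (simp add: S_def)
  have S_K: "S k \<in> K" for k
    by (induction k) (auto simp: S_def assms sup C_K)
  have w_le: "w \<le> S k" for k
    by (induction k) (auto simp: S_def)
  have "S (Suc k) \<le> sup (S k) ((C ^^ Suc k) w)" for k
  proof (induction k)
    case (Suc k)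
    have "S (Suc (Suc k)) \<le> sup w (C (sup (S k) ((C ^^ Suc k) w)))"
      unfolding S_Suc[of "Suc k"] using C_mono[OF Suc] by (simp add: le_supI2)
    also have "\<dots> = sup (S (Suc k)) ((C ^^ Suc (Suc k)) w)"
      by (simp add: C_sup S_Suc sup_assoc)
    finally show ?case .
  qed (simp add: S_def)
  from this[of m] have "S (Suc m) \<le> S m"
    using assms(4) w_le[of m] unfolding C_def[symmetric]
    by (meson dual_order.trans le_sup_iff order_refl)
  then have "C (S m) \<le> S m" by (simp add: S_Suc)
  then have "B \<otimes>\<^sub>v S m \<le> s *\<^sub>R S m"
    using assms(1) by (simp add: C_def less_eq_vec_def field_simps)
  moreover have "S m \<noteq> 0"
    using w_le[of m] pos[OF assms(2)] assms(3) by (metis antisym)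
  ultimately show ?thesis using S_K by blast
qed

text \<open>
  A subeigenvector for the least \<open>r\<close> need not be an eigenvector, but its images under the powers of
  \<open>B / r\<close> decrease to one; minimality of \<open>r\<close> keeps the limit away from zero.
\<close>

theorem exists_eigenvector:
  assumes "v \<in> K" "v \<noteq> 0"
  shows "\<exists>r \<ge> 0. \<exists>u \<in> K. u \<noteq> 0 \<and> B \<otimes>\<^sub>v u = r *\<^sub>R u"
proof -
  obtain r w where r: "0 \<le> r" and w: "w \<in> K" "w \<noteq> 0" "B \<otimes>\<^sub>v w \<le> r *\<^sub>R w"
    and least: "\<And>s x. 0 \<le> s \<Longrightarrow> x \<in> K \<Longrightarrow> x \<noteq> 0 \<Longrightarrow> B \<otimes>\<^sub>v x \<le> s *\<^sub>R x \<Longrightarrow> r \<le> s"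
    using exists_least_subeigenvalue[OF assms] by blast
  show ?thesis
  proof (cases "r = 0")
    case True
    then have "B \<otimes>\<^sub>v w = 0 *\<^sub>R w"
      using w pos[OF invariant[OF w(1)]] by simp
    then show ?thesis using w by blast
  next
    case False
    with r have r0: "0 < r" by simp
    define T where "T = (\<lambda>x. (1 / r) *\<^sub>R (B \<otimes>\<^sub>v x))"
    have T_mono: "T x \<le> T y" if "x \<le> y" for x y
      unfolding T_def using that r0 nonneg by (intro scaleR_left_mono max_mv_mono) auto
    have T_K: "(T ^^ k) w \<in> K" for k
      by (induction k) (auto simp: T_def w r intro!: scale invariant)
    have Tw: "T w \<le> w"
      using w(3) r0 by (simp add: T_def less_eq_vec_def field_simps)
    have T_step: "(T ^^ Suc k) w \<le> (T ^^ k) w" for k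
      by (induction k) (auto simp: Tw T_mono)
    have nn: "0 \<le> (T ^^ k) w $ i" for k i
      using pos[OF T_K[of k]] by (simp add: less_eq_vec_def)
    have "convergent (\<lambda>k. (T ^^ k) w $ i)" for i
    proof -
      have "decseq (\<lambda>k. (T ^^ k) w $ i)"
        using T_step by (intro decseq_SucI) (simp add: less_eq_vec_def)
      from decseq_convergent[OF this, of 0] nn show ?thesis
        by (metis convergentI)
    qed
    then obtain l where l: "\<And>i. (\<lambda>k. (T ^^ k) w $ i) \<longlonglongrightarrow> l i"
      unfolding convergent_def by metis
    define u where "u = (\<chi> i. l i)"
    have lim: "(\<lambda>k. (T ^^ k) w) \<longlonglongrightarrow> u"
      by (rule vec_tendstoI) (simp add: u_def l)
    have "u \<in> K" using closed_sequentially[OF closed _ lim] T_K by blast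
    have "(\<lambda>k. T ((T ^^ k) w)) \<longlonglongrightarrow> T u"
      unfolding T_def by (intro tendsto_intros tendsto_max_mv lim[unfolded T_def])
    moreover have "(\<lambda>k. T ((T ^^ k) w)) \<longlonglongrightarrow> u"
      using LIMSEQ_Suc[OF lim] by simp
    ultimately have "T u = u" by (rule LIMSEQ_unique)
    then have Bu: "B \<otimes>\<^sub>v u = r *\<^sub>R u"
      using r0 by (auto simp: T_def vec_eq_iff field_simps)
    have "u \<noteq> 0"
    proof
      assume "u = 0"
      \<comment> \<open>At zeros of \<open>w\<close> convergence alone does not give the bound; monotonicity does.\<close>
      have "eventually (\<lambda>k. (T ^^ k) w $ i \<le> w $ i / 2) sequentially" for i
      proof (cases "w $ i = 0")
        case True
        have "(T ^^ k) w $ i \<le> w $ i" for k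
        proof (induction k)
          case (Suc k)
          then show ?case using T_step[of k] unfolding less_eq_vec_def
            by (meson order_trans)
        qed simp
        then show ?thesis using True by simp
      next
        case False
        then have "0 < w $ i / 2" using nn[of 0 i] by simp
        moreover have "(\<lambda>k. (T ^^ k) w $ i) \<longlonglongrightarrow> 0"
          using tendsto_vec_nth[OF lim, of i] \<open>u = 0\<close> by simp
        ultimately have "eventually (\<lambda>k. (T ^^ k) w $ i < w $ i / 2) sequentially"
          by (rule order_tendstoD(2)[rotated])
        then show ?thesis by eventually_elim simp
      qed
      then have "eventually (\<lambda>k. \<forall>i. (T ^^ k) w $ i \<le> w $ i / 2) sequentially"
        by (rule eventually_all_finite)
      then obtain N where N: "\<And>k. N \<le> k \<Longrightarrow> \<forall>i. (T ^^ k) w $ i \<le> w $ i / 2"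
        unfolding eventually_sequentially by blast
      \<comment> \<open>Replacing \<open>r\<close> by \<open>r / c\<close> multiplies the iterate of order \<open>Suc N\<close> by exactly \<open>2\<close>.
        The order is positive, as the root and \<open>subeigenvector_of_iterate\<close> require.\<close>
      define c where "c = root (Suc N) 2"
      have c: "1 < c" "c ^ Suc N = 2"
        unfolding c_def by (simp, rule real_root_pow_pos2) auto
      have iterate: "((\<lambda>x. (1 / (r / c)) *\<^sub>R (B \<otimes>\<^sub>v x)) ^^ k) w = c ^ k *\<^sub>R (T ^^ k) w" for k
        using c(1) by (induction k) (simp_all add: T_def max_mv_scaleR)
      have "c ^ Suc N *\<^sub>R (T ^^ Suc N) w \<le> w"
        using N[of "Suc N"] unfolding c(2) by (simp add: less_eq_vec_def field_simps)
      then have "((\<lambda>x. (1 / (r / c)) *\<^sub>R (B \<otimes>\<^sub>v x)) ^^ Suc N) w \<le> w"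
        unfolding iterate .
      from subeigenvector_of_iterate[OF _ w(1,2) this]
      have "\<exists>x \<in> K. x \<noteq> 0 \<and> B \<otimes>\<^sub>v x \<le> (r / c) *\<^sub>R x"
        using r0 c(1) by simp
      then have "r \<le> r / c" using least[of "r / c"] r0 c(1) by auto
      then show False using r0 c(1) by (simp add: field_simps)
    qed
    then show ?thesis using \<open>u \<in> K\<close> Bu r by blast
  qed
qed

end

section \<open>Commuting matrices\<close>

lemma eigencone_invariant:
  assumes "nonneg_mat A" "nonneg_mat B" "A \<otimes>\<^sub>m B = B \<otimes>\<^sub>m A" "0 \<le> \<alpha>"
    and v: "v \<in> max_eigencone A \<alpha>"
  shows "B \<otimes>\<^sub>v v \<in> max_eigencone A \<alpha>"
proof -
  have v0: "0 \<le> v" and Av: "A \<otimes>\<^sub>v v = \<alpha> *\<^sub>R v"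
    using v by (auto simp: max_eigencone_def nonneg_vec_iff_zero_le)
  have "A \<otimes>\<^sub>v (B \<otimes>\<^sub>v v) = B \<otimes>\<^sub>v (A \<otimes>\<^sub>v v)"
    using assms(1-3) v0 by (metis max_mv_assoc)
  also have "\<dots> = \<alpha> *\<^sub>R (B \<otimes>\<^sub>v v)"
    using assms(4) by (simp add: Av max_mv_scaleR)
  finally show ?thesis
    using max_mv_nonneg[OF assms(2) v0]
    by (simp add: max_eigencone_def nonneg_vec_iff_zero_le)
qed

lemma invariant_max_cone_eigencone:
  assumes "nonneg_mat A" "nonneg_mat B" "A \<otimes>\<^sub>m B = B \<otimes>\<^sub>m A" "0 \<le> \<alpha>"
  shows "invariant_max_cone B (max_eigencone A \<alpha>)"
proof
  have eq: "max_eigencone A \<alpha> = (\<Inter>i. {v. 0 \<le> v $ i}) \<inter> {v. A \<otimes>\<^sub>v v = \<alpha> *\<^sub>R v}"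
    by (auto simp: max_eigencone_def nonneg_vec_def)
  show "closed (max_eigencone A \<alpha>)"
    unfolding eq by (intro closed_Int closed_INT ballI closed_Collect_le closed_Collect_eq
        continuous_intros)
  show "sup v w \<in> max_eigencone A \<alpha>"
    if "v \<in> max_eigencone A \<alpha>" "w \<in> max_eigencone A \<alpha>" for v w
  proof -
    have "mono ((*) \<alpha>)" using assms(4) by (simp add: monoI mult_left_mono)
    then have "\<alpha> * max a b = max (\<alpha> * a) (\<alpha> * b)" for a b by (rule max_of_mono[symmetric])
    then show ?thesis
      using that max_mv_sup[OF assms(1), of v w]
      by (auto simp: max_eigencone_def nonneg_vec_iff_zero_le vec_eq_iff sup_vec_nth le_supI1)
  qed
qed (use assms eigencone_invariant[OF assms] in \<open>auto simp: max_eigencone_def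
      nonneg_vec_iff_zero_le max_mv_scaleR mult.commute scaleR_nonneg_nonneg\<close>)

theorem theorem3p2:
  fixes A B :: "real ^ 'n ^ 'n"
  assumes "nonneg_mat A" and "nonneg_mat B"
    and "A \<otimes>\<^sub>m B = B \<otimes>\<^sub>m A"
  shows "\<forall>\<alpha> \<in> max_eigenvalues A. \<exists>\<mu> \<in> max_eigenvalues B.
           \<exists>v \<in> max_eigencone A \<alpha> \<inter> max_eigencone B \<mu>. v \<noteq> 0"
proof
  fix \<alpha> assume "\<alpha> \<in> max_eigenvalues A"
  then obtain v where \<alpha>: "0 \<le> \<alpha>" and v: "v \<in> max_eigencone A \<alpha>" "v \<noteq> 0"
    by (auto simp: max_eigenvalues_def max_eigencone_def)
  interpret invariant_max_cone B "max_eigencone A \<alpha>"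
    using assms \<alpha> by (rule invariant_max_cone_eigencone)
  obtain \<mu> u where "0 \<le> \<mu>" "u \<in> max_eigencone A \<alpha>" "u \<noteq> 0" "B \<otimes>\<^sub>v u = \<mu> *\<^sub>R u"
    using exists_eigenvector[OF v] by blast
  then show "\<exists>\<mu> \<in> max_eigenvalues B. \<exists>v \<in> max_eigencone A \<alpha> \<inter> max_eigencone B \<mu>. v \<noteq> 0"
    by (auto simp: max_eigenvalues_def max_eigencone_def)
qed

end
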